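(* Let $\Gamma\subset\mathbb C$ be a positively oriented simple closed $C^1$ contour containing none of the exact nodes $\rho_1(q),\dots,\rho_r(q)$, put $R_\Gamma=\max_{z\in\Gamma}|z|$, and define the observable boundary margin $$\widetilde\zeta_q(\Gamma)=\min_{z\in\Gamma}\sigma_{\min}\bigl(\widetilde A_q(z)\bigr).$$ If $\max_{0\le n\le 2r-1}|\eta_n^{(q)}|\le\varepsilon$ and $$r\varepsilon(1+R_\Gamma)<\bigl(2^{1/r}-1\bigr)\widetilde\zeta_q(\Gamma),$$ then the exact characteristic $\Psi_q$ and the observed characteristic $\widetilde\Psi_q$ have the same number of zeros in the interior of $\Gamma$, counted with multiplicity.
   Context: Let $r\ge1$, $q\in(0,1)$, $\alpha_1,\dots,\alpha_r\in\mathbb C$, $w_1,\dots,w_r\in\mathbb C\setminus\{0\}$, with nodes $\rho_\ell(q)=q^{\alpha_\ell}=e^{\alpha_\ell\log q}$ assumed pairwise distinct. Put $\mu_n^{(q)}=\sum_{\ell=1}^r w_\ell\rho_\ell(q)^n$ for $n\ge0$. The noisy samples are $\widetilde y_n^{(q)}=\mu_n^{(q)}+\eta_n^{(q)}$, $n=0,\dots,2r-1$, with $\eta_n^{(q)}\in\mathbb C$. For $s=0,1$ set $H_{r,s}^{(q)}=(\mu_{i+j+s}^{(q)})_{i,j=0}^{r-1}$ and $\widetilde H_{r,s}^{(q)}=(\widetilde y_{i+j+s}^{(q)})_{i,j=0}^{r-1}$. Put $A_q(z)=H_{r,1}^{(q)}-zH_{r,0}^{(q)}$, $\Psi_q(z)=\det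 A_q(z)$, $\widetilde A_q(z)=\widetilde H_{r,1}^{(q)}-z\widetilde H_{r,0}^{(q)}$, $\widetilde\Psi_q(z)=\det\widetilde A_q(z)$. Here $\sigma_{\min}$ denotes the smallest singular value. *)

theory Defs
  imports
    "HOL-Complex_Analysis.Complex_Analysis"
    "Jordan_Normal_Form.Spectral_Radius"
    "Jordan_Normal_Form.Schur_Decomposition"
begin

(* Indices l of exponents and weights run over {1..r}; matrix indices over {0..<r}. *)

definition node :: "(nat \<Rightarrow> complex) \<Rightarrow> real \<Rightarrow> nat \<Rightarrow> complex" where
  "node \<alpha> q l = exp (\<alpha> l * complex_of_real (ln q))"

definition moment :: "nat \<Rightarrow> (nat \<Rightarrow> complex) \<Rightarrow> (nat \<Rightarrow> complex) \<Rightarrow> real \<Rightarrow> nat \<Rightarrow> complex" where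
  "moment r \<alpha> w q n = (\<Sum>l=1..r. w l * node \<alpha> q l ^ n)"

definition noisy_sample ::
  "nat \<Rightarrow> (nat \<Rightarrow> complex) \<Rightarrow> (nat \<Rightarrow> complex) \<Rightarrow> real \<Rightarrow> (nat \<Rightarrow> complex) \<Rightarrow> nat \<Rightarrow> complex" where
  "noisy_sample r \<alpha> w q \<eta> n = moment r \<alpha> w q n + \<eta> n"

definition hankel :: "nat \<Rightarrow> nat \<Rightarrow> (nat \<Rightarrow> complex) \<Rightarrow> complex mat" where
  "hankel r s y = mat r r (\<lambda>(i, j). y (i + j + s))"

definition pencil :: "nat \<Rightarrow> (nat \<Rightarrow> complex) \<Rightarrow> complex \<Rightarrow> complex mat" where
  "pencil r y z = hankel r 1 y - z \<cdot>\<^sub>m hankel r 0 y"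

(* Determinant.det is the determinant of matrices with a natural-number dimension;
   the name is qualified because HOL-Analysis has a det of its own. *)
definition characteristic :: "nat \<Rightarrow> (nat \<Rightarrow> complex) \<Rightarrow> complex \<Rightarrow> complex" where
  "characteristic r y z = Determinant.det (pencil r y z)"

(* The singular values of A are the square roots of the eigenvalues of A\<^sup>* A, which are
   real and nonnegative; Re only changes the type. *)
definition singular_values :: "complex mat \<Rightarrow> real set" where
  "singular_values A = (\<lambda>k. sqrt (Re k)) ` spectrum (mat_adjoint A * A)"

definition sigma_min :: "complex mat \<Rightarrow> real" where
  "sigma_min A = Min (singular_values A)"

(* On a contour, a nonempty compact set, the infimum and the supremum below are attained. *)
definition boundary_margin :: "nat \<Rightarrow> (nat \<Rightarrow> complex) \<Rightarrow> complex set \<Rightarrow> real" where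
  "boundary_margin r y \<Gamma> = (INF z\<in>\<Gamma>. sigma_min (pencil r y z))"

definition max_modulus :: "complex set \<Rightarrow> real" where
  "max_modulus \<Gamma> = (SUP z\<in>\<Gamma>. cmod z)"

(* The derivative is one-sided at the endpoints, so that values of \<gamma> outside {0..1} are
   irrelevant; C1_differentiable_on would use two-sided derivatives there. *)
definition C1_path :: "(real \<Rightarrow> complex) \<Rightarrow> bool" where
  "C1_path \<gamma> \<longleftrightarrow> (\<exists>D. (\<forall>t\<in>{0..1}. (\<gamma> has_vector_derivative D t) (at t within {0..1}))
      \<and> continuous_on {0..1} D)"

definition simple_closed_C1_contour :: "(real \<Rightarrow> complex) \<Rightarrow> bool" where
  "simple_closed_C1_contour \<gamma> \<longleftrightarrow>
     C1_path \<gamma> \<and> simple_path \<gamma> \<and> pathfinish \<gamma> = pathstart \<gamma>"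

definition positively_oriented :: "(real \<Rightarrow> complex) \<Rightarrow> bool" where
  "positively_oriented \<gamma> \<longleftrightarrow> (\<forall>z \<in> inside (path_image \<gamma>). winding_number \<gamma> z = 1)"

definition zeros_in :: "(complex \<Rightarrow> complex) \<Rightarrow> complex set \<Rightarrow> complex set" where
  "zeros_in f D = {z \<in> D. f z = 0}"

(* Meaningful when f is analytic and has only finitely many zeros in D
   (a sum over an infinite set is 0). *)
definition zero_count :: "(complex \<Rightarrow> complex) \<Rightarrow> complex set \<Rightarrow> int" where
  "zero_count f D = (\<Sum>z\<in>zeros_in f D. zorder f z)"

end

theory Submission
  imports Defs
begin

text \<open>
  On the contour the observed pencil \<open>B\<close> satisfies \<open>\<parallel>B v\<parallel> \<ge> \<zeta> \<parallel>v\<parallel>\<close>, where \<open>\<zeta>\<close> is the boundary margin,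
  while the exact pencil is \<open>B + E\<close> with all entries of \<open>E\<close> at most \<open>\<epsilon> (1 + R)\<close> in modulus, so that
  \<open>\<parallel>E\<parallel> \<le> e = r \<epsilon> (1 + R)\<close>. Hence every eigenvalue of \<open>B\<inverse> E\<close> has modulus at most \<open>e / \<zeta>\<close>, and
  factoring \<open>det (B + E) = det B * det (1 + B\<inverse> E)\<close> over these eigenvalues gives
  \<open>\<bar>det (B + E) - det B\<bar> \<le> ((1 + e / \<zeta>) ^ r - 1) \<bar>det B\<bar>\<close> (\<open>det_perturbation_le\<close>). The smallness
  hypothesis says precisely that \<open>(1 + e / \<zeta>) ^ r < 2\<close>, so the two characteristics differ on the
  contour by less than the modulus of the observed one, and Rouche's theorem equates their zero
  counts (\<open>poly_zero_count_Rouche\<close>). Both characteristics are polynomials with no zero on the contour, so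
  their zero sets are finite.

  The singular values are given as square roots of eigenvalues of \<open>B\<^sup>* B\<close>, so the lower bound
  \<open>\<parallel>B v\<parallel> \<ge> \<sigma> \<parallel>v\<parallel>\<close> needs the variational characterisation of the least singular value
  \<open>\<sigma>\<close>. It is obtained in \<open>least_Rayleigh_quotient_eigenvalue\<close> by a gradient-descent argument
  that avoids both diagonalisation and compactness.
\<close>

section \<open>Squared norms of complex vectors\<close>

definition norm_sq :: "complex Matrix.vec \<Rightarrow> real" where
  "norm_sq v = (\<Sum>i<dim_vec v. (cmod (vec_index v i))\<^sup>2)"

lemma norm_sq_nonneg: "0 \<le> norm_sq v"
  by (simp add: norm_sq_def sum_nonneg)

lemma norm_sq_eq_0_iff:
  assumes "v \<in> carrier_vec n"
  shows "norm_sq v = 0 \<longleftrightarrow> v = 0\<^sub>v n"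
  using assms by (auto simp: norm_sq_def sum_nonneg_eq_0_iff)

lemma norm_sq_pos:
  assumes "v \<in> carrier_vec n" "v \<noteq> 0\<^sub>v n"
  shows "0 < norm_sq v"
  using norm_sq_eq_0_iff[OF assms(1)] assms(2) norm_sq_nonneg[of v] by linarith

lemma norm_sq_smult: "norm_sq (c \<cdot>\<^sub>v v) = (cmod c)\<^sup>2 * norm_sq v"
  by (simp add: norm_sq_def norm_mult power_mult_distrib sum_distrib_left)

lemma norm_sq_conv_cscalar_prod: "complex_of_real (norm_sq v) = v \<bullet>c v"
  by (simp add: norm_sq_def scalar_prod_def lessThan_atLeast0 complex_norm_square del: of_real_power)

lemma norm_sq_minus_real_smult:
  assumes "u \<in> carrier_vec n" "v \<in> carrier_vec n"
  shows "norm_sq (u - complex_of_real t \<cdot>\<^sub>v v) = norm_sq u - 2 * t * Re (u \<bullet>c v) + t\<^sup>2 * norm_sq v"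
proof -
  have *: "(cmod (a - complex_of_real t * b))\<^sup>2
     = (cmod a)\<^sup>2 - 2 * t * Re (a * cnj b) + t\<^sup>2 * (cmod b)\<^sup>2" for a b
    unfolding cmod_power2 by (simp add: algebra_simps power2_eq_square)
  show ?thesis
    using assms by (simp add: norm_sq_def scalar_prod_def lessThan_atLeast0 * sum.distrib
        sum_subtractf flip: sum_distrib_left)
qed

lemma cscalar_prod_mat_adjoint:
  assumes A: "A \<in> carrier_mat n n" and x: "x \<in> carrier_vec n" and y: "y \<in> carrier_vec n"
  shows "(mat_adjoint A *\<^sub>v x) \<bullet>c y = x \<bullet>c (A *\<^sub>v (y :: complex Matrix.vec))"
proof -
  have "(mat_adjoint A *\<^sub>v x) \<bullet>c y
      = (\<Sum>i=0..<n. \<Sum>j=0..<n. cnj (A $$ (j, i)) * vec_index x j * cnj (vec_index y i))"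
    using assms by (auto simp: scalar_prod_def mat_adjoint_def sum_distrib_right intro!: sum.cong)
  also have "\<dots> = (\<Sum>j=0..<n. \<Sum>i=0..<n. cnj (A $$ (j, i)) * vec_index x j * cnj (vec_index y i))"
    by (rule sum.swap)
  also have "\<dots> = x \<bullet>c (A *\<^sub>v y)"
    using assms by (auto simp: scalar_prod_def sum_distrib_left algebra_simps intro!: sum.cong)
  finally show ?thesis .
qed

lemma mat_adjoint_carrier:
  "A \<in> carrier_mat n n \<Longrightarrow> mat_adjoint A \<in> carrier_mat n n"
  by (auto simp: mat_adjoint_def)

text \<open>The operator norm is at most the Frobenius norm, which for entries bounded by \<open>c\<close> is at
  most \<open>n c\<close>: apply the Cauchy-Schwarz inequality to each row.\<close>

lemma norm_sq_mult_mat_vec_le: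
  assumes A: "A \<in> carrier_mat n n" and v: "v \<in> carrier_vec n"
    and c: "\<And>i j. i < n \<Longrightarrow> j < n \<Longrightarrow> cmod (A $$ (i, j)) \<le> c"
  shows "norm_sq (A *\<^sub>v v) \<le> (real n * c)\<^sup>2 * norm_sq v"
proof -
  have "(cmod (vec_index (A *\<^sub>v v) i))\<^sup>2 \<le> real n * c\<^sup>2 * norm_sq v" if i: "i < n" for i
  proof -
    have "cmod (vec_index (A *\<^sub>v v) i) \<le> (\<Sum>j<n. cmod (A $$ (i, j)) * cmod (vec_index v j))"
      using A v i by (auto simp: scalar_prod_def lessThan_atLeast0 norm_mult intro!: sum_norm_le)
    also have "\<dots> \<le> (\<Sum>j<n. c * cmod (vec_index v j))"
      by (intro sum_mono mult_right_mono c i) auto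
    finally have "(cmod (vec_index (A *\<^sub>v v) i))\<^sup>2 \<le> (\<Sum>j<n. c * cmod (vec_index v j))\<^sup>2"
      by (intro power_mono) auto
    also have "\<dots> \<le> (\<Sum>j<n. c\<^sup>2) * (\<Sum>j<n. (cmod (vec_index v j))\<^sup>2)"
      by (rule Cauchy_Schwarz_ineq_sum)
    finally show ?thesis using v by (simp add: norm_sq_def)
  qed
  then have "(\<Sum>i<n. (cmod (vec_index (A *\<^sub>v v) i))\<^sup>2) \<le> (\<Sum>i<n. real n * c\<^sup>2 * norm_sq v)"
    by (intro sum_mono) auto
  then show ?thesis using A by (simp add: norm_sq_def power2_eq_square algebra_simps)
qed

lemma norm_sq_mult_mat_vec_bounded:
  assumes A: "A \<in> carrier_mat n n"
  obtains C where "0 < C" "\<And>v. v \<in> carrier_vec n \<Longrightarrow> norm_sq (A *\<^sub>v v) \<le> C * norm_sq v"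
proof -
  define c where "c = (\<Sum>i<n. \<Sum>j<n. cmod (A $$ (i, j)))"
  have c: "cmod (A $$ (i, j)) \<le> c" if "i < n" "j < n" for i j
  proof -
    have "cmod (A $$ (i, j)) \<le> (\<Sum>j<n. cmod (A $$ (i, j)))"
      using that by (intro member_le_sum) auto
    also have "\<dots> \<le> c"
      unfolding c_def using that
      by (intro member_le_sum[of i "{..<n}" "\<lambda>i. \<Sum>j<n. cmod (A $$ (i, j))"] sum_nonneg) auto
    finally show ?thesis .
  qed
  have "norm_sq (A *\<^sub>v v) \<le> ((real n * c)\<^sup>2 + 1) * norm_sq v" if "v \<in> carrier_vec n" for v
    using norm_sq_mult_mat_vec_le[OF A that c] norm_sq_nonneg[of v] by (simp add: algebra_simps)
  moreover have "0 < (real n * c)\<^sup>2 + 1" by (simp add: add_nonneg_pos)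
  ultimately show ?thesis using that by blast
qed

section \<open>The least singular value\<close>

lemma nonsingular_mat_obtain_inverse:
  assumes A: "(A :: complex mat) \<in> carrier_mat n n" and "Determinant.det A \<noteq> 0"
  obtains C where "C \<in> carrier_mat n n" "C * A = 1\<^sub>m n" "A * C = 1\<^sub>m n"
  using det_non_zero_imp_unit[OF assms, of n]
  by (auto simp: Units_def ring_mat_def)

text \<open>
  Let \<open>m\<close> be the infimum of \<open>\<parallel>B v\<parallel>\<^sup>2 / \<parallel>v\<parallel>\<^sup>2\<close>, so that \<open>Q v = \<parallel>B v\<parallel>\<^sup>2 - m \<parallel>v\<parallel>\<^sup>2\<close> is nonnegative, and
  let \<open>S = B\<^sup>* B - m\<close> be the matrix of this form. One gradient step from \<open>v\<close> in the
  direction \<open>- S v\<close> cannot make \<open>Q\<close> negative, which forces \<open>\<parallel>S v\<parallel>\<^sup>2 \<le> C * Q v\<close>. If \<open>S\<close> were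
  invertible, \<open>\<parallel>v\<parallel>\<^sup>2\<close> would in turn be bounded by a multiple of \<open>\<parallel>S v\<parallel>\<^sup>2\<close>, hence of \<open>Q v\<close>, and \<open>m\<close>
  could be increased. So \<open>m\<close> is an eigenvalue of \<open>B\<^sup>* B\<close>.
\<close>

lemma least_Rayleigh_quotient_eigenvalue:
  assumes B: "B \<in> carrier_mat n n" and n: "0 < n"
  obtains m where "0 \<le> m" "complex_of_real m \<in> spectrum (mat_adjoint B * B)"
    "\<And>v. v \<in> carrier_vec n \<Longrightarrow> m * norm_sq v \<le> norm_sq (B *\<^sub>v v)"
proof -
  define V where "V = {v \<in> carrier_vec n. norm_sq v = 1}"
  define m where "m = (INF v\<in>V. norm_sq (B *\<^sub>v v))"
  define M where "M = mat_adjoint B * B"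
  define S where "S = M - complex_of_real m \<cdot>\<^sub>m 1\<^sub>m n"
  have M: "M \<in> carrier_mat n n" unfolding M_def using mat_adjoint_carrier[OF B] B by simp
  have S: "S \<in> carrier_mat n n" unfolding S_def by (intro minus_carrier_mat) simp
  have bdd: "bdd_below ((\<lambda>v. norm_sq (B *\<^sub>v v)) ` V)"
    by (rule bdd_belowI2[of _ 0]) (rule norm_sq_nonneg)
  have "norm_sq (unit_vec n 0) = 1"
    using n by (simp add: norm_sq_def unit_vec_def if_distrib[of cmod] if_distrib[of "\<lambda>x. x\<^sup>2"] sum.delta cong: if_cong)
  then have "unit_vec n 0 \<in> V" unfolding V_def by simp
  then have ne: "V \<noteq> {}" by blast
  have m0: "0 \<le> m" unfolding m_def by (rule cINF_greatest[OF ne]) (rule norm_sq_nonneg)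
  have m_greatest: "c \<le> m" if "\<And>v. v \<in> carrier_vec n \<Longrightarrow> c * norm_sq v \<le> norm_sq (B *\<^sub>v v)" for c
    unfolding m_def
  proof (rule cINF_greatest[OF ne])
    fix v assume "v \<in> V"
    then show "c \<le> norm_sq (B *\<^sub>v v)" using that[of v] unfolding V_def by simp
  qed
  have m_le: "m * norm_sq v \<le> norm_sq (B *\<^sub>v v)" if v: "v \<in> carrier_vec n" for v
  proof (cases "norm_sq v = 0")
    case True
    then show ?thesis by (simp add: norm_sq_nonneg)
  next
    case False
    then have pos: "0 < norm_sq v" using norm_sq_nonneg[of v] by linarith
    define a where "a = complex_of_real (1 / sqrt (norm_sq v))"
    have a2: "(cmod a)\<^sup>2 = 1 / norm_sq v"
      unfolding a_def norm_of_real using pos by (simp add: power_divide)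
    have "a \<cdot>\<^sub>v v \<in> V" unfolding V_def using v pos by (simp add: norm_sq_smult a2)
    then have "m \<le> norm_sq (B *\<^sub>v (a \<cdot>\<^sub>v v))" unfolding m_def by (rule cINF_lower[OF bdd])
    also have "\<dots> = norm_sq (B *\<^sub>v v) / norm_sq v"
      using B v by (simp add: mult_mat_vec norm_sq_smult a2)
    finally show ?thesis using pos by (simp add: field_simps)
  qed
  obtain C where C: "0 < C" "\<And>v. v \<in> carrier_vec n \<Longrightarrow> norm_sq (B *\<^sub>v v) \<le> C * norm_sq v"
    using norm_sq_mult_mat_vec_bounded[OF B] by blast
  \<comment> \<open>The step length \<open>1 / C\<close> is optimal for the quadratic bound \<open>Q u \<le> C * \<parallel>u\<parallel>\<^sup>2\<close>.\<close>
  have descent: "norm_sq (S *\<^sub>v v) \<le> C * (norm_sq (B *\<^sub>v v) - m * norm_sq v)"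
    if v: "v \<in> carrier_vec n" for v
  proof -
    define u where "u = S *\<^sub>v v"
    have u: "u \<in> carrier_vec n" unfolding u_def using S v by simp
    have "(complex_of_real m \<cdot>\<^sub>m 1\<^sub>m n) *\<^sub>v v = complex_of_real m \<cdot>\<^sub>v v"
      using v by (intro eq_vecI) (simp_all add: smult_scalar_prod_distrib[of _ n])
    then have "S *\<^sub>v v = M *\<^sub>v v - complex_of_real m \<cdot>\<^sub>v v"
      unfolding S_def using M v by (simp add: minus_mult_distrib_mat_vec[of _ n n])
    then have "complex_of_real (norm_sq u) = (M *\<^sub>v v - complex_of_real m \<cdot>\<^sub>v v) \<bullet>c u"
      unfolding norm_sq_conv_cscalar_prod by (simp add: u_def)
    also have "\<dots> = (M *\<^sub>v v) \<bullet>c u - complex_of_real m * (v \<bullet>c u)"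
      using M u v by (simp add: minus_scalar_prod_distrib[of _ n])
    also have "(M *\<^sub>v v) \<bullet>c u = (B *\<^sub>v v) \<bullet>c (B *\<^sub>v u)"
      unfolding M_def using B u v mat_adjoint_carrier[OF B]
      by (simp add: cscalar_prod_mat_adjoint)
    finally have "norm_sq u = Re ((B *\<^sub>v v) \<bullet>c (B *\<^sub>v u) - complex_of_real m * (v \<bullet>c u))"
      by (metis Re_complex_of_real)
    then have nu: "norm_sq u = Re ((B *\<^sub>v v) \<bullet>c (B *\<^sub>v u)) - m * Re (v \<bullet>c u)"
      by simp
    have Bu: "B *\<^sub>v (v - complex_of_real (1 / C) \<cdot>\<^sub>v u) = B *\<^sub>v v - complex_of_real (1 / C) \<cdot>\<^sub>v (B *\<^sub>v u)"
      using B u v by (simp add: mult_minus_distrib_mat_vec mult_mat_vec)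
    have "m * norm_sq (v - complex_of_real (1 / C) \<cdot>\<^sub>v u) \<le> norm_sq (B *\<^sub>v (v - complex_of_real (1 / C) \<cdot>\<^sub>v u))"
      using u v by (intro m_le) simp
    then have "0 \<le> norm_sq (B *\<^sub>v v) - m * norm_sq v - 2 * (1 / C) * norm_sq u
        + (1 / C)\<^sup>2 * (norm_sq (B *\<^sub>v u) - m * norm_sq u)"
      unfolding Bu using B u v
      by (simp only: norm_sq_minus_real_smult[of _ n] mult_mat_vec_carrier nu)
         (simp add: algebra_simps)
    also have "\<dots> \<le> norm_sq (B *\<^sub>v v) - m * norm_sq v - 2 * (1 / C) * norm_sq u + (1 / C)\<^sup>2 * (C * norm_sq u)"
      using C(2)[OF u] m0 norm_sq_nonneg[of u]
      by (intro add_left_mono mult_left_mono) (auto intro: order_trans[rotated])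
    also have "\<dots> = norm_sq (B *\<^sub>v v) - m * norm_sq v - norm_sq u / C"
      using C(1) by (simp add: field_simps power2_eq_square)
    finally show ?thesis using C(1) by (simp add: u_def field_simps)
  qed
  have "Determinant.det S = 0"
  proof (rule ccontr)
    assume "Determinant.det S \<noteq> 0"
    from nonsingular_mat_obtain_inverse[OF S this] obtain T
      where T: "T \<in> carrier_mat n n" "T * S = 1\<^sub>m n" by blast
    obtain D where D: "0 < D" "\<And>v. v \<in> carrier_vec n \<Longrightarrow> norm_sq (T *\<^sub>v v) \<le> D * norm_sq v"
      using norm_sq_mult_mat_vec_bounded[OF T(1)] by blast
    have "(m + 1 / (C * D)) * norm_sq v \<le> norm_sq (B *\<^sub>v v)" if v: "v \<in> carrier_vec n" for v
    proof -
      have "v = T *\<^sub>v (S *\<^sub>v v)"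
        using T S v by (metis assoc_mult_mat_vec one_mult_mat_vec)
      then have "norm_sq v \<le> D * norm_sq (S *\<^sub>v v)" using D(2)[of "S *\<^sub>v v"] S v by simp
      also have "\<dots> \<le> D * (C * (norm_sq (B *\<^sub>v v) - m * norm_sq v))"
        using D(1) descent[OF v] by simp
      finally show ?thesis using C(1) D(1) by (simp add: field_simps)
    qed
    then have "m + 1 / (C * D) \<le> m" by (rule m_greatest)
    then show False using mult_pos_pos[OF C(1) D(1)] by simp
  qed
  moreover have "char_matrix M (complex_of_real m) = S"
    unfolding char_matrix_def S_def using M by (intro eq_matI) auto
  ultimately have "complex_of_real m \<in> spectrum M"
    unfolding spectrum_def by (simp add: eigenvalue_det[OF M])
  then show ?thesis using that m0 m_le unfolding M_def by blast
qed

text \<open>An eigenvalue \<open>k\<close> of \<open>B\<^sup>* B\<close> with eigenvector \<open>v\<close> satisfies \<open>k \<parallel>v\<parallel>\<^sup>2 = \<parallel>B v\<parallel>\<^sup>2\<close>. This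
  is what makes the boundary margin an infimum of a set that is bounded below.\<close>

lemma sigma_min_nonneg:
  assumes B: "B \<in> carrier_mat n n" and n: "0 < n"
  shows "0 \<le> sigma_min B"
proof -
  define M where "M = mat_adjoint B * B"
  have M: "M \<in> carrier_mat n n" unfolding M_def using mat_adjoint_carrier[OF B] B by simp
  have "0 \<le> Re k" if "k \<in> spectrum M" for k
  proof -
    from that obtain v where v: "v \<in> carrier_vec n" "v \<noteq> 0\<^sub>v n" "M *\<^sub>v v = k \<cdot>\<^sub>v v"
      using M unfolding spectrum_def eigenvalue_def eigenvector_def by auto
    have "k * complex_of_real (norm_sq v) = (M *\<^sub>v v) \<bullet>c v"
      unfolding norm_sq_conv_cscalar_prod v(3) using v(1) by simp
    also have "\<dots> = complex_of_real (norm_sq (B *\<^sub>v v))"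
      unfolding norm_sq_conv_cscalar_prod M_def using B v(1) mat_adjoint_carrier[OF B]
      by (simp add: cscalar_prod_mat_adjoint)
    finally have "Re (k * complex_of_real (norm_sq v)) = norm_sq (B *\<^sub>v v)" by simp
    then have "0 \<le> Re k * norm_sq v" using norm_sq_nonneg[of "B *\<^sub>v v"] by simp
    moreover have "0 < norm_sq v" by (rule norm_sq_pos[OF v(1,2)])
    ultimately show ?thesis by (simp add: zero_le_mult_iff)
  qed
  then show ?thesis
    using card_finite_spectrum(1)[OF M] spectrum_non_empty[OF M n]
    unfolding sigma_min_def singular_values_def M_def[symmetric] by simp
qed

lemma sigma_min_norm_sq_le:
  assumes B: "B \<in> carrier_mat n n" and n: "0 < n" and v: "v \<in> carrier_vec n"
  shows "(sigma_min B)\<^sup>2 * norm_sq v \<le> norm_sq (B *\<^sub>v v)"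
proof -
  define M where "M = mat_adjoint B * B"
  have M: "M \<in> carrier_mat n n" unfolding M_def using mat_adjoint_carrier[OF B] B by simp
  obtain m where m: "0 \<le> m" "complex_of_real m \<in> spectrum M"
    "m * norm_sq v \<le> norm_sq (B *\<^sub>v v)"
    using least_Rayleigh_quotient_eigenvalue[OF B n, folded M_def] v by metis
  have "sqrt m \<in> singular_values B"
    unfolding singular_values_def M_def[symmetric] using imageI[OF m(2), of "\<lambda>k. sqrt (Re k)"] by simp
  moreover have "finite (singular_values B)"
    unfolding singular_values_def M_def[symmetric] using card_finite_spectrum(1)[OF M] by simp
  ultimately have "sigma_min B \<le> sqrt m" unfolding sigma_min_def by (intro Min_le)
  then have "(sigma_min B)\<^sup>2 \<le> (sqrt m)\<^sup>2"
    using sigma_min_nonneg[OF B n] by (rule power_mono)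
  then have "(sigma_min B)\<^sup>2 \<le> m" using m(1) by simp
  then have "(sigma_min B)\<^sup>2 * norm_sq v \<le> m * norm_sq v"
    by (intro mult_right_mono norm_sq_nonneg)
  with m(3) show ?thesis by linarith
qed

section \<open>Relative perturbation of a determinant\<close>

text \<open>With eigenvalues \<open>a\<^sub>i\<close> of \<open>X\<close>, counted with multiplicity, the determinant is
  \<open>\<Prod>i. 1 + a\<^sub>i\<close>; expanding the product and estimating every term other than \<open>1\<close> by its
  modulus gives the bound.\<close>

lemma det_one_plus_minus_one_le:
  assumes X: "(X :: complex mat) \<in> carrier_mat n n"
    and ev: "\<And>k. k \<in> spectrum X \<Longrightarrow> cmod k \<le> \<kappa>"
  shows "cmod (Determinant.det (1\<^sub>m n + X) - 1) \<le> (1 + \<kappa>) ^ n - 1"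
proof -
  obtain as where as: "char_poly X = (\<Prod>a\<leftarrow>as. [:- a, 1:])" "length as = n"
    using char_poly_factorized[OF X] by blast
  have "- char_matrix X (-1) = (-1) \<cdot>\<^sub>m (1\<^sub>m n + X)"
    using X unfolding char_matrix_def by (intro eq_matI) auto
  then have "(-1) ^ n * Determinant.det (1\<^sub>m n + X) = poly (char_poly X) (-1)"
    unfolding char_poly_matrix[OF X] using X by (simp add: det_smult)
  also have "\<dots> = (\<Prod>i<n. - (1 + as ! i))"
    unfolding as(1) poly_prod_list prod.list_conv_set_nth
    using as(2) by (simp add: lessThan_atLeast0 poly_prod algebra_simps)
  also have "\<dots> = (-1) ^ n * (\<Prod>i<n. 1 + as ! i)"
    by (simp only: prod_uminus card_lessThan)
  finally have "Determinant.det (1\<^sub>m n + X) = (\<Prod>i<n. 1 + as ! i)" by simp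
  then have "cmod (Determinant.det (1\<^sub>m n + X) - 1) \<le> (\<Prod>i<n. 1 + cmod (as ! i)) - 1"
    using norm_prod_minus1_le_prod_minus1[of "\<lambda>i. as ! i" "{..<n}"] by simp
  moreover have "cmod (as ! i) \<le> \<kappa>" if "i < n" for i
  proof (rule ev)
    have "poly (char_poly X) (as ! i) = 0"
      unfolding as(1) poly_prod_list prod_list_zero_iff using that as(2) by (auto simp: image_iff intro!: bexI[of _ "as ! i"])
    then show "as ! i \<in> spectrum X" by (simp add: spectrum_root_char_poly[OF X])
  qed
  then have "(\<Prod>i<n. 1 + cmod (as ! i)) \<le> (\<Prod>i<n. 1 + \<kappa>)"
    by (intro prod_mono) (auto intro: add_nonneg_nonneg)
  ultimately show ?thesis by simp
qed

text \<open>If \<open>k\<close> is an eigenvalue of \<open>B\<inverse> E\<close> with eigenvector \<open>v\<close>, then \<open>E v = k B v\<close>, and comparing norms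
  gives \<open>\<bar>k\<bar> s \<le> e\<close>, so the preceding bound applies to \<open>X = B\<inverse> E\<close>
  with \<open>\<kappa> = e / s\<close>.\<close>

lemma det_perturbation_le:
  assumes B: "B \<in> carrier_mat n n" and E: "E \<in> carrier_mat n n"
    and s: "0 < s" and e: "0 \<le> e"
    and lower: "\<And>v. v \<in> carrier_vec n \<Longrightarrow> s\<^sup>2 * norm_sq v \<le> norm_sq (B *\<^sub>v v)"
    and upper: "\<And>v. v \<in> carrier_vec n \<Longrightarrow> norm_sq (E *\<^sub>v v) \<le> e\<^sup>2 * norm_sq v"
  shows "Determinant.det B \<noteq> 0"
    and "cmod (Determinant.det (B + E) - Determinant.det B)
       \<le> ((1 + e / s) ^ n - 1) * cmod (Determinant.det B)"
proof -
  show "Determinant.det B \<noteq> 0"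
  proof
    assume "Determinant.det B = 0"
    then obtain v where v: "v \<in> carrier_vec n" "v \<noteq> 0\<^sub>v n" "B *\<^sub>v v = 0\<^sub>v n"
      using det_0_iff_vec_prod_zero[OF B] by blast
    have "0 < s\<^sup>2 * norm_sq v" using s norm_sq_pos[OF v(1,2)] by simp
    also have "\<dots> \<le> 0" using lower[OF v(1)] unfolding v(3) by (simp add: norm_sq_def)
    finally show False by simp
  qed
  then obtain C where C: "C \<in> carrier_mat n n" "C * B = 1\<^sub>m n" "B * C = 1\<^sub>m n"
    using nonsingular_mat_obtain_inverse[OF B] by blast
  have CE: "C * E \<in> carrier_mat n n" using C E by simp
  have BCE: "B * (C * E) = E" using C(3) E by (simp add: assoc_mult_mat[OF B C(1) E, symmetric])
  have "cmod k \<le> e / s" if "k \<in> spectrum (C * E)" for k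
  proof -
    from that obtain v where v: "v \<in> carrier_vec n" "v \<noteq> 0\<^sub>v n" "(C * E) *\<^sub>v v = k \<cdot>\<^sub>v v"
      using CE C(1) unfolding spectrum_def eigenvalue_def eigenvector_def by auto
    have "E *\<^sub>v v = B *\<^sub>v ((C * E) *\<^sub>v v)"
      by (simp add: assoc_mult_mat_vec[OF B CE v(1), symmetric] BCE)
    also have "\<dots> = k \<cdot>\<^sub>v (B *\<^sub>v v)" unfolding v(3) using B v(1) by (rule mult_mat_vec)
    finally have "(cmod k)\<^sup>2 * norm_sq (B *\<^sub>v v) \<le> e\<^sup>2 * norm_sq v"
      using upper[OF v(1)] by (simp add: norm_sq_smult)
    moreover have "(cmod k)\<^sup>2 * (s\<^sup>2 * norm_sq v) \<le> (cmod k)\<^sup>2 * norm_sq (B *\<^sub>v v)"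
      using lower[OF v(1)] by (intro mult_left_mono) auto
    ultimately have "(cmod k * s)\<^sup>2 * norm_sq v \<le> e\<^sup>2 * norm_sq v"
      by (simp add: power_mult_distrib mult.assoc)
    then have "(cmod k * s)\<^sup>2 \<le> e\<^sup>2" using norm_sq_pos[OF v(1,2)] by simp
    then have "cmod k * s \<le> e" using e by (rule power2_le_imp_le)
    then show ?thesis using s by (simp add: field_simps)
  qed
  then have *: "cmod (Determinant.det (1\<^sub>m n + C * E) - 1) \<le> (1 + e / s) ^ n - 1"
    by (rule det_one_plus_minus_one_le[OF CE])
  have "B + E = B * (1\<^sub>m n + C * E)"
    using B BCE by (simp add: mult_add_distrib_mat[OF B one_carrier_mat CE])
  then have "Determinant.det (B + E) = Determinant.det B * Determinant.det (1\<^sub>m n + C * E)"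
    using B CE by (simp add: det_mult[of B n])
  then have "cmod (Determinant.det (B + E) - Determinant.det B)
      = cmod (Determinant.det B) * cmod (Determinant.det (1\<^sub>m n + C * E) - 1)"
    by (simp add: algebra_simps flip: norm_mult)
  with * show "cmod (Determinant.det (B + E) - Determinant.det B)
       \<le> ((1 + e / s) ^ n - 1) * cmod (Determinant.det B)"
    by (simp add: mult.commute mult_left_mono)
qed

section \<open>Counting zeros inside the contour\<close>

lemma characteristic_is_poly: "\<exists>p. characteristic r y = poly p"
proof -
  define P where "P = Matrix.mat r r (\<lambda>(i, j). [: y (i + j + 1), - y (i + j) :])"
  have "characteristic r y z = poly (Determinant.det P) z" for z
    unfolding characteristic_def
    by (rule poly_det_cong[symmetric, of _ r])
       (auto simp: P_def pencil_def hankel_def)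
  then show ?thesis by (intro exI ext)
qed

text \<open>A valid path may fail to be differentiable at finitely many points, so discarding the two
  endpoints turns the one-sided derivatives into two-sided ones.\<close>

lemma simple_closed_C1_contour_imp_valid_path:
  assumes "simple_closed_C1_contour \<gamma>"
  shows "valid_path \<gamma>"
proof -
  from assms obtain D where D: "\<forall>t\<in>{0..1}. (\<gamma> has_vector_derivative D t) (at t within {0..1})"
    "continuous_on {0..1} D" and \<gamma>: "path \<gamma>"
    unfolding simple_closed_C1_contour_def C1_path_def by (auto intro: simple_path_imp_path)
  have "\<gamma> C1_differentiable_on {0..1} - {0, 1}"
    unfolding C1_differentiable_on_def
  proof (intro exI[of _ D] conjI ballI)
    fix t :: real assume t: "t \<in> {0..1} - {0, 1}"
    then have "(\<gamma> has_vector_derivative D t) (at t within {0..1})" using D(1) by blast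
    then have "(\<gamma> has_vector_derivative D t) (at t within {0<..<1})"
      by (rule has_vector_derivative_within_subset) auto
    moreover have "at t within {0<..<1} = at t" using t by (intro at_within_open) auto
    ultimately show "(\<gamma> has_vector_derivative D t) (at t)" by simp
  next
    show "continuous_on ({0..1} - {0, 1}) D" using D(2) by (rule continuous_on_subset) auto
  qed
  then show ?thesis
    using \<gamma> unfolding valid_path_def piecewise_C1_differentiable_on_def path_def
    by (metis finite.emptyI finite.insertI)
qed

text \<open>Zeros outside the contour have winding number \<open>0\<close> and those inside have winding number \<open>1\<close>,
  so the weighted sum over all zeros in Rouche's theorem reduces to the zero count.\<close>

lemma zero_count_eq_winding_sum:
  assumes \<gamma>: "path \<gamma>" "pathfinish \<gamma> = pathstart \<gamma>" and pos: "positively_oriented \<gamma>"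
    and fin: "finite {z. f z = 0}" and nz: "\<And>z. z \<in> path_image \<gamma> \<Longrightarrow> f z \<noteq> 0"
  shows "complex_of_int (zero_count f (inside (path_image \<gamma>)))
       = (\<Sum>z | f z = 0. winding_number \<gamma> z * complex_of_int (zorder f z))"
proof -
  let ?I = "inside (path_image \<gamma>)"
  have "(\<Sum>z | f z = 0. winding_number \<gamma> z * complex_of_int (zorder f z))
      = (\<Sum>z\<in>zeros_in f ?I. winding_number \<gamma> z * complex_of_int (zorder f z))"
  proof (rule sum.mono_neutral_right[OF fin])
    show "zeros_in f ?I \<subseteq> {z. f z = 0}" unfolding zeros_in_def by blast
    show "\<forall>z\<in>{z. f z = 0} - zeros_in f ?I. winding_number \<gamma> z * complex_of_int (zorder f z) = 0"
    proof
      fix z assume "z \<in> {z. f z = 0} - zeros_in f ?I"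
      then have "z \<in> outside (path_image \<gamma>)"
        using nz inside_Un_outside[of "path_image \<gamma>"] unfolding zeros_in_def by blast
      then show "winding_number \<gamma> z * complex_of_int (zorder f z) = 0"
        using winding_number_zero_in_outside[OF \<gamma>] by simp
    qed
  qed
  also have "\<dots> = (\<Sum>z\<in>zeros_in f ?I. complex_of_int (zorder f z))"
    using pos unfolding positively_oriented_def zeros_in_def by (intro sum.cong) auto
  finally show ?thesis unfolding zero_count_def by simp
qed

text \<open>The strict inequality keeps both polynomials from vanishing on the contour. In particular
  neither is the zero polynomial, so their zero sets in the whole plane are finite and Rouche's
  theorem applies on \<open>UNIV\<close>.\<close>

lemma poly_zero_count_Rouche:
  assumes contour: "simple_closed_C1_contour \<gamma>" and pos: "positively_oriented \<gamma>"
    and less: "\<And>z. z \<in> path_image \<gamma> \<Longrightarrow> cmod (poly p z - poly q z) < cmod (poly q z)"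
  shows "finite {z. poly p z = 0}" and "finite {z. poly q z = 0}"
    and "zero_count (poly p) (inside (path_image \<gamma>)) = zero_count (poly q) (inside (path_image \<gamma>))"
proof -
  have valid: "valid_path \<gamma>" by (rule simple_closed_C1_contour_imp_valid_path[OF contour])
  have loop: "pathfinish \<gamma> = pathstart \<gamma>"
    using contour unfolding simple_closed_C1_contour_def by blast
  have nz: "poly p z \<noteq> 0" "poly q z \<noteq> 0" if "z \<in> path_image \<gamma>" for z
    using less[OF that] by auto
  have "p \<noteq> 0" "q \<noteq> 0" using nz[OF pathstart_in_path_image] by auto
  then show fin: "finite {z. poly p z = 0}" "finite {z. poly q z = 0}"
    by (simp_all add: poly_roots_finite)
  have "(\<Sum>z | poly p z = 0. winding_number \<gamma> z * complex_of_int (zorder (poly p) z))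
      = (\<Sum>z | poly q z = 0. winding_number \<gamma> z * complex_of_int (zorder (poly q) z))"
    using Rouche_theorem[of UNIV "poly q" "\<lambda>z. poly p z - poly q z" \<gamma>] fin valid loop less connected_UNIV
    by (simp add: holomorphic_intros)
  then have "complex_of_int (zero_count (poly p) (inside (path_image \<gamma>)))
      = complex_of_int (zero_count (poly q) (inside (path_image \<gamma>)))"
    using valid_path_imp_path[OF valid] loop pos fin nz by (simp add: zero_count_eq_winding_sum)
  then show "zero_count (poly p) (inside (path_image \<gamma>)) = zero_count (poly q) (inside (path_image \<gamma>))"
    by simp
qed

section \<open>Equality of the zero counts\<close>

theorem corollary4p4:
  fixes r :: nat and q \<epsilon> :: real and \<alpha> w \<eta> :: "nat \<Rightarrow> complex" and \<gamma> :: "real \<Rightarrow> complex"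
  assumes "r \<ge> 1"
    and "0 < q" and "q < 1"
    and "\<And>l. l \<in> {1..r} \<Longrightarrow> w l \<noteq> 0"
    and "inj_on (node \<alpha> q) {1..r}"
    and "simple_closed_C1_contour \<gamma>" and "positively_oriented \<gamma>"
    and "\<And>l. l \<in> {1..r} \<Longrightarrow> node \<alpha> q l \<notin> path_image \<gamma>"
    and "(MAX n\<in>{0..2 * r - 1}. cmod (\<eta> n)) \<le> \<epsilon>"
    and "real r * \<epsilon> * (1 + max_modulus (path_image \<gamma>))
           < (2 powr (1 / real r) - 1) * boundary_margin r (noisy_sample r \<alpha> w q \<eta>) (path_image \<gamma>)"
  shows "finite (zeros_in (characteristic r (moment r \<alpha> w q)) (inside (path_image \<gamma>)))
    \<and> finite (zeros_in (characteristic r (noisy_sample r \<alpha> w q \<eta>)) (inside (path_image \<gamma>)))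
    \<and> zero_count (characteristic r (moment r \<alpha> w q)) (inside (path_image \<gamma>))
      = zero_count (characteristic r (noisy_sample r \<alpha> w q \<eta>)) (inside (path_image \<gamma>))"
proof -
  define \<mu> where "\<mu> = moment r \<alpha> w q"
  define y where "y = noisy_sample r \<alpha> w q \<eta>"
  define R where "R = max_modulus (path_image \<gamma>)"
  define \<zeta> where "\<zeta> = boundary_margin r y (path_image \<gamma>)"
  define \<theta> where "\<theta> = 2 powr (1 / real r) - (1::real)"
  have r: "0 < r" using assms(1) by simp
  have noise: "cmod (\<eta> n) \<le> \<epsilon>" if "n \<le> 2 * r - 1" for n
    using assms(9) that by (subst (asm) Max_le_iff) auto
  have \<epsilon>: "0 \<le> \<epsilon>" using noise[of 0] norm_ge_zero[of "\<eta> 0"] by linarith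
  have compact: "compact (path_image \<gamma>)"
    by (rule compact_valid_path_image[OF simple_closed_C1_contour_imp_valid_path[OF assms(6)]])
  have R: "cmod z \<le> R" if "z \<in> path_image \<gamma>" for z
    unfolding R_def max_modulus_def
  proof (rule cSUP_upper[OF that])
    show "bdd_above (cmod ` path_image \<gamma>)"
      using compact_imp_bounded[OF compact] unfolding bounded_iff bdd_above_def by auto
  qed
  have "0 \<le> R" by (rule order_trans[OF norm_ge_zero R[OF pathstart_in_path_image]])
  have pencil_carrier: "pencil r u z \<in> carrier_mat r r" for u z
    unfolding pencil_def hankel_def by (intro minus_carrier_mat) simp
  have margin: "\<zeta> \<le> sigma_min (pencil r y z)" if "z \<in> path_image \<gamma>" for z
    unfolding \<zeta>_def boundary_margin_def
  proof (rule cINF_lower[OF _ that])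
    show "bdd_below ((\<lambda>z. sigma_min (pencil r y z)) ` path_image \<gamma>)"
      by (rule bdd_belowI2[of _ 0]) (rule sigma_min_nonneg[OF pencil_carrier r])
  qed
  have \<theta>: "0 < \<theta>" unfolding \<theta>_def using r by simp
  have small: "real r * \<epsilon> * (1 + R) < \<theta> * \<zeta>"
    using assms(10) unfolding R_def \<theta>_def \<zeta>_def y_def .
  \<comment> \<open>The strict smallness hypothesis forces the margin to be positive, so the observed pencil is
    nonsingular on the contour.\<close>
  have "0 \<le> real r * \<epsilon> * (1 + R)" using \<epsilon> \<open>0 \<le> R\<close> by simp
  then have "0 < \<theta> * \<zeta>" using small by linarith
  then have \<zeta>: "0 < \<zeta>" using \<theta> by (simp add: zero_less_mult_iff)
  have "cmod (characteristic r \<mu> z - characteristic r y z) < cmod (characteristic r y z)"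
    if z: "z \<in> path_image \<gamma>" for z
  proof -
    define B where "B = pencil r y z"
    define E where "E = pencil r \<mu> z - B"
    define e where "e = real r * (\<epsilon> * (1 + R))"
    have B: "B \<in> carrier_mat r r" unfolding B_def by (rule pencil_carrier)
    have E: "E \<in> carrier_mat r r" unfolding E_def by (rule minus_carrier_mat[OF B])
    have BE: "B + E = pencil r \<mu> z"
      unfolding E_def using B pencil_carrier[of \<mu> z] by (intro eq_matI) auto
    have entry: "cmod (E $$ (i, j)) \<le> \<epsilon> * (1 + R)" if "i < r" "j < r" for i j
    proof -
      have "E $$ (i, j) = z * \<eta> (i + j) - \<eta> (i + j + 1)"
        unfolding E_def B_def pencil_def hankel_def y_def \<mu>_def noisy_sample_def
        using that by (simp add: algebra_simps)
      also have "cmod \<dots> \<le> cmod z * cmod (\<eta> (i + j)) + cmod (\<eta> (i + j + 1))"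
        by (metis norm_mult norm_triangle_ineq4)
      also have "\<dots> \<le> R * \<epsilon> + \<epsilon>"
        using that \<open>0 \<le> R\<close> by (intro add_mono mult_mono noise R z) auto
      finally show ?thesis by (simp add: algebra_simps)
    qed
    have e: "0 \<le> e" unfolding e_def using \<epsilon> \<open>0 \<le> R\<close> by simp
    have lower: "\<zeta>\<^sup>2 * norm_sq v \<le> norm_sq (B *\<^sub>v v)" if "v \<in> carrier_vec r" for v
    proof -
      have "\<zeta>\<^sup>2 * norm_sq v \<le> (sigma_min B)\<^sup>2 * norm_sq v"
        using margin[OF z] \<zeta> unfolding B_def
        by (intro mult_right_mono power_mono norm_sq_nonneg) auto
      also have "\<dots> \<le> norm_sq (B *\<^sub>v v)" by (rule sigma_min_norm_sq_le[OF B r that])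
      finally show ?thesis .
    qed
    have upper: "norm_sq (E *\<^sub>v v) \<le> e\<^sup>2 * norm_sq v" if "v \<in> carrier_vec r" for v
      unfolding e_def by (rule norm_sq_mult_mat_vec_le[OF E that entry])
    note perturb = det_perturbation_le[OF B E \<zeta> e lower upper]
    have "e / \<zeta> < \<theta>" using small \<zeta> unfolding e_def by (simp add: field_simps)
    then have "(1 + e / \<zeta>) ^ r < (1 + \<theta>) ^ r"
      using e \<zeta> r by (intro power_strict_mono) auto
    also have "\<dots> = 2" unfolding \<theta>_def using r by (simp add: powr_realpow[symmetric] powr_powr)
    finally have "((1 + e / \<zeta>) ^ r - 1) * cmod (Determinant.det B) < 1 * cmod (Determinant.det B)"
      using perturb(1) by (intro mult_strict_right_mono) auto
    with perturb(2) show ?thesis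
      unfolding characteristic_def BE unfolding B_def by simp
  qed
  moreover obtain p where p: "characteristic r \<mu> = poly p"
    using characteristic_is_poly by blast
  moreover obtain p' where p': "characteristic r y = poly p'"
    using characteristic_is_poly by blast
  ultimately have "\<And>z. z \<in> path_image \<gamma> \<Longrightarrow> cmod (poly p z - poly p' z) < cmod (poly p' z)" by simp
  note rouche = poly_zero_count_Rouche[OF assms(6,7) this]
  have "finite (zeros_in (poly p) D)" "finite (zeros_in (poly p') D)" for D
    using rouche(1,2) by (simp_all add: zeros_in_def)
  with rouche(3) have "finite (zeros_in (characteristic r \<mu>) (inside (path_image \<gamma>)))
    \<and> finite (zeros_in (characteristic r y) (inside (path_image \<gamma>)))
    \<and> zero_count (characteristic r \<mu>) (inside (path_image \<gamma>))
      = zero_count (characteristic r y) (inside (path_image \<gamma>))"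
    unfolding p p' by simp
  then show ?thesis unfolding \<mu>_def y_def .
qed

end
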